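(* For every $r\ge0$, the independence number of the intersection graph of $P_r$ satisfies $\alpha(P_r)=q_r$, and $|P_r|=2^{r+1}q_r$, where $q_r=4^{2^r}$.
   Context: All rectangles are closed and axis-parallel. For a rectangle family $P$, $\alpha(P)$ denotes the independence number of its intersection graph, i.e. the maximum size $\nu(P)$ of a pairwise disjoint subfamily. Construction of $P_r$. Write $[q]=\{0,1,\dots,q-1\}$. Each $P_r$ is a finite rectangle family drawn in a square $[0,L]^2$ together with $q=q_r$ vertical marker lines $x=\xi_0,\dots,x=\xi_{q-1}$ and $q$ horizontal marker lines $y=\eta_0,\dots,y=\eta_{q-1}$ (in increasing order). Base: $P_0$ has $L=30$, $q=4$, $\xi=(3,11,19,27)$, $\eta=(3,11,21,27)$ and consists of the eight rectangles $T=[0,30]\times[26,28]$, $U_L=[0,16]\times[20,22]$, $U_R=[14,30]\times[20,22]$, $C_0=[0,8]\times[2,10]$, $C_1=[6,16]\times[8,14]$, $C_2=[14,24]\times[8,14]$, $C_3=[22,30]\times[2,12]$, $Q=[6,24]\times[0,4]$. Crossbar step: given $P$ with data $L,q,\xi,\eta$, put $M=L+1$, and for $R=[x_1,x_2]\times[y_1,y_2]\in P$ and $i,j\in[q]$ let $$H_i(R)=[Mx_1,Mx_2]\times[M\xi_i+y_1,M\xi_i+y_2],\qquad V_j(R)=[M\xi_j+y_1,M\xi_j+y_2]\times[Mx_1,Mx_2].$$ $C(P)$ is the family of all $H_i(R)$ and $V_j(R)$ with $R\in P$, $i,j\in[q]$. It is drawn in $[0,ML+L]^2$, with $q^2$ vertical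 markers $\xi'_{(j,t)}=M\xi_j+\eta_t$ and $q^2$ horizontal markers $\eta'_{(i,t)}=M\xi_i+\eta_t$, indexed by $[q]\times[q]$ and ordered lexicographically. Recursion: $P_{r+1}=C(P_r)$ for $r\ge0$; thus $q_0=4$ and $q_{r+1}=q_r^2$. *)

theory Defs
  imports Complex_Main
begin

definition intersection_edges :: "'a set set \<Rightarrow> ('a set \<times> 'a set) set" where
  "intersection_edges F = {(A, B). A \<in> F \<and> B \<in> F \<and> A \<noteq> B \<and> A \<inter> B \<noteq> {}}"

definition independent_set :: "'v set \<Rightarrow> ('v \<times> 'v) set \<Rightarrow> 'v set \<Rightarrow> bool" where
  "independent_set V E S \<longleftrightarrow> S \<subseteq> V \<and> (\<forall>a\<in>S. \<forall>b\<in>S. (a, b) \<notin> E)"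

text \<open>As a maximum over subsets of the vertex set, this is meaningful for finite graphs only.\<close>

definition independence_number :: "'v set \<Rightarrow> ('v \<times> 'v) set \<Rightarrow> nat" where
  "independence_number V E = Max {card S | S. independent_set V E S}"

definition alpha :: "'a set set \<Rightarrow> nat" where
  "alpha F = independence_number F (intersection_edges F)"

lemma alpha_eq_max_disjoint_subfamily:
  "alpha F = Max {card S | S. S \<subseteq> F \<and> pairwise disjnt S}"
proof -
  have "independent_set F (intersection_edges F) S \<longleftrightarrow> S \<subseteq> F \<and> pairwise disjnt S" for S
    by (auto simp: independent_set_def intersection_edges_def pairwise_def disjnt_def)
  then show ?thesis
    by (simp add: alpha_def independence_number_def)
qed

text \<open>\<open>Rect x1 x2 y1 y2\<close> lists the endpoints of the two sides of a rectangle;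
  the rectangle itself is the point set \<open>region (Rect x1 x2 y1 y2)\<close>.\<close>

datatype rect = Rect real real real real

fun region :: "rect \<Rightarrow> (real \<times> real) set" where
  "region (Rect x1 x2 y1 y2) = {x1..x2} \<times> {y1..y2}"

text \<open>A family together with its marker lines. Only the values of \<open>xi\<close> and \<open>eta\<close> at
  indices below \<open>num_markers\<close> are relevant.\<close>

record drawing =
  rects :: "rect set"
  side :: real
  num_markers :: nat
  xi :: "nat \<Rightarrow> real"
  eta :: "nat \<Rightarrow> real"

definition base :: drawing where
  "base = \<lparr>
     rects = {Rect 0 30 26 28, Rect 0 16 20 22, Rect 14 30 20 22,
              Rect 0 8 2 10, Rect 6 16 8 14, Rect 14 24 8 14, Rect 22 30 2 12,
              Rect 6 24 0 4},
     side = 30,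
     num_markers = 4,
     xi = (\<lambda>k. [3, 11, 19, 27] ! k),
     eta = (\<lambda>k. [3, 11, 21, 27] ! k)\<rparr>"

fun h_copy :: "real \<Rightarrow> real \<Rightarrow> rect \<Rightarrow> rect" where
  "h_copy M c (Rect x1 x2 y1 y2) = Rect (M * x1) (M * x2) (M * c + y1) (M * c + y2)"

fun v_copy :: "real \<Rightarrow> real \<Rightarrow> rect \<Rightarrow> rect" where
  "v_copy M c (Rect x1 x2 y1 y2) = Rect (M * c + y1) (M * c + y2) (M * x1) (M * x2)"

text \<open>The marker with index pair \<open>(j, t)\<close> has position \<open>j * q + t\<close> in the lexicographic
  order on pairs of indices below \<open>q\<close>. By construction the new vertical and horizontal
  markers have the same coordinates; in both cases the offsets come from \<open>eta\<close>.\<close>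

definition crossbar :: "drawing \<Rightarrow> drawing" where
  "crossbar D = (let q = num_markers D; M = side D + 1 in \<lparr>
     rects = {h_copy M (xi D i) R | i R. i < q \<and> R \<in> rects D} \<union>
             {v_copy M (xi D j) R | j R. j < q \<and> R \<in> rects D},
     side = M * side D + side D,
     num_markers = q ^ 2,
     xi = (\<lambda>k. M * xi D (k div q) + eta D (k mod q)),
     eta = (\<lambda>k. M * xi D (k div q) + eta D (k mod q))\<rparr>)"

primrec drawing_of :: "nat \<Rightarrow> drawing" where
  "drawing_of 0 = base"
| "drawing_of (Suc r) = crossbar (drawing_of r)"

definition rect_family :: "nat \<Rightarrow> (real \<times> real) set set" where
  "rect_family r = region ` rects (drawing_of r)"

definition marker_count :: "nat \<Rightarrow> nat" where
  "marker_count r = num_markers (drawing_of r)"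

end

theory Submission
  imports Defs
begin

text \<open>
  The independence number is controlled by a stronger, inductive property, \<open>stab_bound\<close>
  below: a pairwise disjoint subfamily \<open>I\<close> has at most as many members as there are vertical marker
  lines that stab some member of \<open>I\<close> (meet it away from its right edge), and likewise, away from the
  top edge, for horizontal lines. Since there are \<open>q\<close> markers
  in each direction, this gives \<open>\<alpha> \<le> q\<close>. Both directions are needed because the vertical
  marker \<open>(j, t)\<close> of the crossbar stabs a horizontal copy of \<open>R\<close> if the old vertical marker \<open>j\<close> stabs
  \<open>R\<close>, and it stabs the copy of \<open>R\<close> in column \<open>j\<close> if the old horizontal marker \<open>t\<close> stabs \<open>R\<close>.

  For the crossbar step (\<open>crossbar_vstabs_bound\<close>), let \<open>H\<^sub>i\<close> and \<open>V\<^sub>j\<close> be the parts of \<open>I\<close> in the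
  individual copies, pulled back to the old drawing, and let \<open>A\<^sub>i\<close> and \<open>B\<^sub>j\<close> be the sets of old vertical
  markers that stab them. A copy of \<open>R\<close> in row \<open>i\<close> crosses a copy of \<open>S\<close> in column \<open>j\<close> when marker \<open>j\<close>
  stabs \<open>R\<close> and marker \<open>i\<close> stabs \<open>S\<close>. As \<open>I\<close> is disjoint, \<open>j \<in> A\<^sub>i\<close> and \<open>i \<in> B\<^sub>j\<close> never hold together.
  Put \<open>U = (\<Union>i. A\<^sub>i)\<close>. Counting pairs \<open>(i, j)\<close> with \<open>j \<in> U\<close> gives
  \<open>(\<Sum>i. |H\<^sub>i|) + (\<Sum>j\<in>U. |V\<^sub>j|) \<le> (\<Sum>i. |A\<^sub>i|) + (\<Sum>j\<in>U. |B\<^sub>j|) \<le> q |U|\<close>,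
  and all \<open>q |U|\<close> new vertical markers \<open>(j, t)\<close> with \<open>j \<in> U\<close> stab \<open>I\<close>. For \<open>j \<notin> U\<close> the horizontal bound
  supplies \<open>|V\<^sub>j|\<close> values \<open>t\<close> for which the marker \<open>(j, t)\<close> stabs \<open>I\<close>. The bound for
  horizontal markers follows because the crossbar is symmetric under reflection in the diagonal.

  Conversely, \<open>q\<close> horizontal copies of a disjoint family of size \<open>q\<close> form one of size \<open>q\<^sup>2\<close>. In the base
  drawing, \<open>T\<close> is isolated, \<open>U\<^sub>L\<close> and \<open>U\<^sub>R\<close> form an edge, and \<open>C\<^sub>0, C\<^sub>1, C\<^sub>2, C\<^sub>3, Q\<close> form a 5-cycle, so a
  disjoint family of size \<open>1 + 1 + 2 = 4\<close> exists. The number of rectangles follows from the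
  fact that all \<open>2q\<close> copies of all rectangles are distinct.
\<close>

section \<open>Counting\<close>

lemma alpha_eqI:
  assumes S: "S \<subseteq> F" "pairwise disjnt S" "card S = n"
    and upper: "\<And>T. T \<subseteq> F \<Longrightarrow> pairwise disjnt T \<Longrightarrow> card T \<le> n"
  shows "alpha F = n"
proof -
  let ?C = "{card T | T. T \<subseteq> F \<and> pairwise disjnt T}"
  have le: "m \<le> n" if "m \<in> ?C" for m using that upper by auto
  then have "finite ?C" by (meson finite_nat_set_iff_bounded_le)
  moreover have "n \<in> ?C" using S by blast
  ultimately show ?thesis
    unfolding alpha_eq_max_disjoint_subfamily using le by (intro Max_eqI)
qed

lemma card_UN_image_le:
  assumes "finite A" "\<And>i. finite (F i)"
  shows "card (\<Union>i\<in>A. f i ` F i) \<le> (\<Sum>i\<in>A. card (F i))"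
  using card_UN_le[OF assms(1)] by (rule order_trans) (intro sum_mono card_image_le assms(2))

section \<open>Stabbing spans and grid drawings\<close>

text \<open>Spans are half-open so that, with integer coordinates, a marker in the span leaves a full unit to its
  right. After scaling, that unit has room for an entire copy of the old drawing
  (lemma \<open>xi_stays_in_span\<close>).\<close>
fun xspan :: "rect \<Rightarrow> real set" where
  "xspan (Rect x1 x2 y1 y2) = {x1..<x2}"

fun yspan :: "rect \<Rightarrow> real set" where
  "yspan (Rect x1 x2 y1 y2) = {y1..<y2}"

definition disjoint_rects :: "rect set \<Rightarrow> bool" where
  "disjoint_rects I \<longleftrightarrow> pairwise (\<lambda>R S. disjnt (region R) (region S)) I"

definition vstabs :: "drawing \<Rightarrow> rect set \<Rightarrow> nat set" where
  "vstabs D I = {k. k < num_markers D \<and> (\<exists>R\<in>I. xi D k \<in> xspan R)}"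

definition hstabs :: "drawing \<Rightarrow> rect set \<Rightarrow> nat set" where
  "hstabs D I = {k. k < num_markers D \<and> (\<exists>R\<in>I. eta D k \<in> yspan R)}"

definition stab_bound :: "drawing \<Rightarrow> bool" where
  "stab_bound D \<longleftrightarrow> (\<forall>I. I \<subseteq> rects D \<longrightarrow> disjoint_rects I \<longrightarrow>
     card I \<le> card (vstabs D I) \<and> card I \<le> card (hstabs D I))"

fun on_grid :: "real \<Rightarrow> rect \<Rightarrow> bool" where
  "on_grid L (Rect x1 x2 y1 y2) \<longleftrightarrow> {x1, x2, y1, y2} \<subseteq> \<int> \<and>
     0 \<le> x1 \<and> x1 < x2 \<and> x2 \<le> L \<and> 0 \<le> y1 \<and> y1 < y2 \<and> y2 \<le> L"

locale grid_drawing =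
  fixes D :: drawing
  assumes side_Ints: "side D \<in> \<int>"
    and side_nonneg: "0 \<le> side D"
    and finite_rects: "finite (rects D)"
    and rects_on_grid: "R \<in> rects D \<Longrightarrow> on_grid (side D) R"
    and markers_Ints: "k < num_markers D \<Longrightarrow> xi D k \<in> \<int> \<and> eta D k \<in> \<int>"
    and markers_bounds: "k < num_markers D \<Longrightarrow>
      0 \<le> xi D k \<and> xi D k \<le> side D \<and> 0 \<le> eta D k \<and> eta D k \<le> side D"
    and xi_inj: "inj_on (xi D) {..<num_markers D}"
    and eta_inj: "inj_on (eta D) {..<num_markers D}"

lemma Ints_less_imp_add1_le:
  fixes a b :: real
  assumes "a \<in> \<int>" "b \<in> \<int>" "a < b"
  shows "a + 1 \<le> b"
  using assms by (auto elim!: Ints_cases)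

lemma inj_on_region: "inj_on region {R. on_grid L R}"
proof (rule inj_onI)
  fix R S assume a: "R \<in> {R. on_grid L R}" "S \<in> {R. on_grid L R}" and eq: "region R = region S"
  then show "R = S"
    by (cases R; cases S) (auto simp: times_eq_iff)
qed

text \<open>Grid rectangles have nonempty interior, so they are determined by their point sets and distinct
  ones stay distinct as point sets.\<close>
lemma disjoint_rects_iff_regions:
  assumes "\<And>R. R \<in> I \<Longrightarrow> on_grid L R"
  shows "disjoint_rects I \<longleftrightarrow> pairwise disjnt (region ` I)"
proof -
  have "region R = region S \<longleftrightarrow> R = S" if "R \<in> I" "S \<in> I" for R S
    using inj_on_eq_iff[OF inj_on_region] assms that by auto
  then show ?thesis
    by (auto simp: disjoint_rects_def pairwise_def)
qed

text \<open>Coordinates in the crossbar have two scales: a multiple of \<open>L + 1\<close> plus an offset in \<open>[0, L]\<close>.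
  The offset is too small to bridge two different multiples, so both parts can be read off.\<close>
lemma two_scale_unique:
  fixes a b s t L :: real
  assumes "a \<in> \<int>" "b \<in> \<int>" "0 \<le> s" "s \<le> L" "0 \<le> t" "t \<le> L"
    and eq: "(L + 1) * a + s = (L + 1) * b + t"
  shows "a = b \<and> s = t"
proof -
  have "\<not> u < v" if "u \<in> \<int>" "v \<in> \<int>" "0 \<le> x" "x \<le> L" "0 \<le> y" "y \<le> L"
    "(L + 1) * u + x = (L + 1) * v + y" for u v x y :: real
  proof
    assume "u < v"
    then have "u + 1 \<le> v" using Ints_less_imp_add1_le that by blast
    then have "(L + 1) * (u + 1) \<le> (L + 1) * v"
      using that by (intro mult_left_mono) auto
    then show False using that by (simp add: algebra_simps)
  qed
  from this[of a b s t] this[of b a t s] have "a = b" using assms by fastforce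
  then show ?thesis using eq by simp
qed

text \<open>Reflection in the diagonal exchanges horizontal and vertical copies. It carries every
  statement about horizontal copies to one about vertical copies.\<close>
fun flip :: "rect \<Rightarrow> rect" where
  "flip (Rect x1 x2 y1 y2) = Rect y1 y2 x1 x2"

lemma flip_flip [simp]: "flip (flip R) = R" by (cases R) simp

lemma inj_flip: "inj_on flip I" by (metis flip_flip inj_onI)

lemma flip_h_copy [simp]: "flip (h_copy M c R) = v_copy M c R"
  by (cases R) simp

lemma flip_v_copy [simp]: "flip (v_copy M c R) = h_copy M c R"
  by (cases R) simp

lemma xspan_flip [simp]: "xspan (flip R) = yspan R"
  by (cases R) simp

lemma on_grid_flip [simp]: "on_grid L (flip R) = on_grid L R"
  by (cases R) auto

lemma disjnt_region_flip [simp]: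
  "disjnt (region (flip R)) (region (flip S)) = disjnt (region R) (region S)"
  by (cases R; cases S) (auto simp: disjnt_def Times_Int_Times)

lemma disjoint_rects_flip: "disjoint_rects (flip ` I) = disjoint_rects I"
proof -
  have "flip R = flip S \<longleftrightarrow> R = S" for R S by (metis flip_flip)
  then show ?thesis by (auto simp: disjoint_rects_def pairwise_image pairwise_def)
qed

lemma disjoint_rectsD:
  "disjoint_rects I \<Longrightarrow> R \<in> I \<Longrightarrow> S \<in> I \<Longrightarrow> R \<noteq> S \<Longrightarrow> disjnt (region R) (region S)"
  unfolding disjoint_rects_def pairwise_def by blast

section \<open>Geometry of the crossbar\<close>

text \<open>A copy is the image under a nonsingular affine map, which scales one axis
  and translates the other.\<close>
lemma disjnt_h_copy_iff:
  assumes "0 < M"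
  shows "disjnt (region (h_copy M c R)) (region (h_copy M c S)) \<longleftrightarrow> disjnt (region R) (region S)"
proof (cases R; cases S)
  fix x1 x2 y1 y2 u1 u2 v1 v2
  assume RS: "R = Rect x1 x2 y1 y2" "S = Rect u1 u2 v1 v2"
  have m: "max (M * a) (M * b) = M * max a b" "min (M * a) (M * b) = M * min a b" for a b
    using assms by (auto simp: max_def min_def)
  have "M * max x1 u1 \<le> M * min x2 u2 \<longleftrightarrow> max x1 u1 \<le> min x2 u2"
    using assms by simp
  moreover have "max (M * c + y1) (M * c + v1) \<le> min (M * c + y2) (M * c + v2)
      \<longleftrightarrow> max y1 v1 \<le> min y2 v2"
    by auto
  ultimately show ?thesis
    unfolding RS by (simp add: disjnt_def Times_Int_Times m not_le[symmetric] del: max.bounded_iff min.bounded_iff)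
qed

lemma h_copy_inj: "0 < M \<Longrightarrow> h_copy M c R = h_copy M c S \<longleftrightarrow> R = S"
  by (cases R; cases S) auto

lemma disjnt_v_copy_iff:
  assumes "0 < M"
  shows "disjnt (region (v_copy M c R)) (region (v_copy M c S)) \<longleftrightarrow> disjnt (region R) (region S)"
  using disjnt_h_copy_iff[OF assms, of c R S] disjnt_region_flip[of "h_copy M c R" "h_copy M c S"]
  by simp

lemma v_copy_inj: "0 < M \<Longrightarrow> v_copy M c R = v_copy M c S \<longleftrightarrow> R = S"
  using h_copy_inj flip_h_copy flip_v_copy by metis

lemma crossbar_simps:
  "rects (crossbar D) =
     (\<Union>i<num_markers D. h_copy (side D + 1) (xi D i) ` rects D) \<union>
     (\<Union>j<num_markers D. v_copy (side D + 1) (xi D j) ` rects D)"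
  "side (crossbar D) = (side D + 1) * side D + side D"
  "num_markers (crossbar D) = num_markers D ^ 2"
  "xi (crossbar D) k =
     (side D + 1) * xi D (k div num_markers D) + eta D (k mod num_markers D)"
  "eta (crossbar D) k = xi (crossbar D) k"
  by (auto simp: crossbar_def Let_def)

lemma crossbar_flip: "flip ` rects (crossbar D) = rects (crossbar D)"
  by (auto simp: crossbar_simps image_Un image_UN image_image)

lemma hstabs_crossbar: "hstabs (crossbar D) I = vstabs (crossbar D) (flip ` I)"
  by (auto simp: hstabs_def vstabs_def crossbar_simps(5))

lemma pair_index:
  assumes "j < q" "t < (q::nat)"
  shows "j * q + t < q ^ 2" "(j * q + t) div q = j" "(j * q + t) mod q = t"
proof -
  have "j * q + t < (j + 1) * q" using assms by simp
  also have "\<dots> \<le> q * q" using assms by (intro mult_right_mono) auto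
  finally show "j * q + t < q ^ 2" by (simp add: power2_eq_square)
qed (use assms in auto)

lemma pair_index_inverse:
  assumes "k < q ^ 2"
  shows "k div q < q" "k mod q < (q::nat)"
proof -
  have "q > 0" using assms by (cases q) auto
  then show "k div q < q" "k mod q < q"
    using assms by (auto simp: less_mult_imp_div_less power2_eq_square)
qed

context grid_drawing
begin

abbreviation "q \<equiv> num_markers D"
abbreviation "M \<equiv> side D + 1"

lemma M_pos: "0 < M" using side_nonneg by simp

lemma xi_stays_in_span:
  assumes "R \<in> rects D" "j < q" "xi D j \<in> xspan R" "0 \<le> s" "s \<le> side D"
  shows "M * xi D j + s \<in> xspan (h_copy M c R)"
proof (cases R)
  case (Rect x1 x2 y1 y2)
  have "xi D j + 1 \<le> x2"
    using assms rects_on_grid[OF assms(1)] markers_Ints[OF assms(2)] Rect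
    by (intro Ints_less_imp_add1_le) auto
  then have "M * (xi D j + 1) \<le> M * x2" using M_pos by (intro mult_left_mono) auto
  moreover have "M * x1 \<le> M * xi D j" using M_pos assms Rect by (intro mult_left_mono) auto
  ultimately show ?thesis using assms Rect by (simp add: algebra_simps)
qed

text \<open>The crossing rule behind the upper bound. The lower left corner of the intersection
  serves as a common point.\<close>
lemma h_copy_meets_v_copy:
  assumes R: "R \<in> rects D" and S: "S \<in> rects D" and ij: "i < q" "j < q"
    and j: "xi D j \<in> xspan R" and i: "xi D i \<in> xspan S"
  shows "\<not> disjnt (region (h_copy M (xi D i) R)) (region (v_copy M (xi D j) S))"
proof (cases R; cases S)
  fix x1 x2 y1 y2 u1 u2 v1 v2
  assume RS: "R = Rect x1 x2 y1 y2" "S = Rect u1 u2 v1 v2"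
  have b: "0 \<le> y1" "y1 < y2" "y2 \<le> side D" "0 \<le> v1" "v1 < v2" "v2 \<le> side D"
    using rects_on_grid[OF R] rects_on_grid[OF S] by (auto simp: RS)
  have "(M * xi D j + v1, M * xi D i + y1) \<in>
      region (h_copy M (xi D i) R) \<inter> region (v_copy M (xi D j) S)"
    using xi_stays_in_span[OF R ij(2) j, of v1 0] xi_stays_in_span[OF S ij(1) i, of y1 0] b
    by (simp add: RS)
  then show ?thesis unfolding disjnt_def by blast
qed

text \<open>Horizontal copies with different indices lie in disjoint strips of height \<open>side D\<close>.\<close>
lemma h_copies_separate:
  assumes R: "R \<in> rects D" and S: "S \<in> rects D" and i: "i < q" and j: "j < q" and "i \<noteq> j"
  shows "disjnt (region (h_copy M (xi D i) R)) (region (h_copy M (xi D j) S))"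
proof (cases R; cases S)
  fix x1 x2 y1 y2 u1 u2 v1 v2
  assume RS: "R = Rect x1 x2 y1 y2" "S = Rect u1 u2 v1 v2"
  have b: "0 \<le> y1" "y2 \<le> side D" "0 \<le> v1" "v2 \<le> side D"
    using rects_on_grid[OF R] rects_on_grid[OF S] by (auto simp: RS)
  have "xi D i \<noteq> xi D j"
    using xi_inj i j \<open>i \<noteq> j\<close> by (auto dest: inj_onD)
  then have "False" if "M * xi D i + y1 \<le> y" "y \<le> M * xi D i + y2"
    "M * xi D j + v1 \<le> y" "y \<le> M * xi D j + v2" for y
    using two_scale_unique[of "xi D i" "xi D j" "y - M * xi D i" "side D" "y - M * xi D j"]
      markers_Ints[OF i] markers_Ints[OF j] b that by auto
  then show ?thesis unfolding RS disjnt_def by auto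
qed

text \<open>A horizontal copy is at least \<open>M\<close> wide, a vertical copy at most \<open>M - 1\<close>.\<close>
lemma h_copy_neq_v_copy:
  assumes R: "R \<in> rects D" and S: "S \<in> rects D"
  shows "h_copy M c R \<noteq> v_copy M d S"
proof (cases R; cases S)
  fix x1 x2 y1 y2 u1 u2 v1 v2
  assume RS: "R = Rect x1 x2 y1 y2" "S = Rect u1 u2 v1 v2"
  have "x1 + 1 \<le> x2"
    using rects_on_grid[OF R] RS by (intro Ints_less_imp_add1_le) auto
  then have "M * (x1 + 1) \<le> M * x2" using M_pos by (intro mult_left_mono) auto
  moreover have "v2 - v1 \<le> side D" using rects_on_grid[OF S] RS by auto
  ultimately show ?thesis unfolding RS by (auto simp: algebra_simps)
qed

lemma on_grid_h_copy:
  assumes R: "R \<in> rects D" and i: "i < q"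
  shows "on_grid (side (crossbar D)) (h_copy M (xi D i) R)"
proof (cases R)
  case (Rect x1 x2 y1 y2)
  have "x2 \<le> side D" "y2 \<le> side D" "0 \<le> x1" "0 \<le> y1" "x1 < x2" "y1 < y2"
    "x1 \<in> \<int>" "x2 \<in> \<int>" "y1 \<in> \<int>" "y2 \<in> \<int>"
    using rects_on_grid[OF R] Rect by auto
  moreover have "M * x2 \<le> M * side D + side D"
    using mult_left_mono[OF \<open>x2 \<le> side D\<close>, of M] side_nonneg M_pos by linarith
  moreover have "M * xi D i + y2 \<le> M * side D + side D"
    using mult_left_mono[of "xi D i" "side D" M] markers_bounds[OF i] \<open>y2 \<le> side D\<close> M_pos
    by linarith
  moreover have "0 \<le> M * xi D i" using M_pos markers_bounds[OF i] by simp
  ultimately show ?thesis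
    using Rect M_pos side_Ints side_nonneg markers_Ints[OF i] unfolding crossbar_simps
    by (auto intro!: Ints_add Ints_mult)
qed

lemma grid_drawing_crossbar: "grid_drawing (crossbar D)"
proof
  show "side (crossbar D) \<in> \<int>" "0 \<le> side (crossbar D)"
    using side_Ints side_nonneg by (auto simp: crossbar_simps)
  show "finite (rects (crossbar D))" using finite_rects by (auto simp: crossbar_simps)
  show "on_grid (side (crossbar D)) R" if "R \<in> rects (crossbar D)" for R
  proof -
    have "on_grid (side (crossbar D)) (v_copy M (xi D i) S)" if "S \<in> rects D" "i < q" for i S
      using on_grid_h_copy[OF that] on_grid_flip[of _ "h_copy M (xi D i) S"] by simp
    then show ?thesis using that on_grid_h_copy by (auto simp: crossbar_simps(1))
  qed
  show k: "xi (crossbar D) k \<in> \<int> \<and> eta (crossbar D) k \<in> \<int>"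
    "0 \<le> xi (crossbar D) k \<and> xi (crossbar D) k \<le> side (crossbar D) \<and>
     0 \<le> eta (crossbar D) k \<and> eta (crossbar D) k \<le> side (crossbar D)"
    if "k < num_markers (crossbar D)" for k
  proof -
    have *: "k div q < q" "k mod q < q" using pair_index_inverse that by (auto simp: crossbar_simps)
    show "xi (crossbar D) k \<in> \<int> \<and> eta (crossbar D) k \<in> \<int>"
      using markers_Ints[OF *(1)] markers_Ints[OF *(2)] side_Ints by (simp add: crossbar_simps)
    have "M * xi D (k div q) \<le> M * side D"
      using M_pos markers_bounds[OF *(1)] by (intro mult_left_mono) auto
    moreover have "0 \<le> M * xi D (k div q)"
      using M_pos markers_bounds[OF *(1)] by simp
    ultimately show "0 \<le> xi (crossbar D) k \<and> xi (crossbar D) k \<le> side (crossbar D) \<and>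
       0 \<le> eta (crossbar D) k \<and> eta (crossbar D) k \<le> side (crossbar D)"
      using markers_bounds[OF *(2)] unfolding crossbar_simps by linarith
  qed
  show inj: "inj_on (xi (crossbar D)) {..<num_markers (crossbar D)}"
  proof (rule inj_onI)
    fix k l assume "k \<in> {..<num_markers (crossbar D)}" "l \<in> {..<num_markers (crossbar D)}"
    then have *: "k div q < q" "k mod q < q" "l div q < q" "l mod q < q"
      using pair_index_inverse by (auto simp: crossbar_simps)
    assume "xi (crossbar D) k = xi (crossbar D) l"
    then have "xi D (k div q) = xi D (l div q) \<and> eta D (k mod q) = eta D (l mod q)"
      using * markers_Ints markers_bounds
      by (intro two_scale_unique[of _ _ _ "side D"]) (auto simp: crossbar_simps)
    then have "k div q = l div q" "k mod q = l mod q"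
      using * xi_inj eta_inj by (auto dest: inj_onD)
    then show "k = l" by (metis div_mult_mod_eq)
  qed
  then show "inj_on (eta (crossbar D)) {..<num_markers (crossbar D)}"
    by (simp add: inj_on_def crossbar_simps(5))
qed

text \<open>Copies with different indices are disjoint and nonempty, hence distinct.\<close>
lemma card_UN_h_copies:
  assumes "I \<subseteq> rects D"
  shows "card (\<Union>i<q. h_copy M (xi D i) ` I) = q * card I"
proof -
  have neq: "h_copy M (xi D i) R \<noteq> h_copy M (xi D j) S"
    if "R \<in> I" "S \<in> I" "i < q" "j < q" "i \<noteq> j" for R S i j
  proof
    assume eq: "h_copy M (xi D i) R = h_copy M (xi D j) S"
    have "disjnt (region (h_copy M (xi D i) R)) (region (h_copy M (xi D j) S))"
      using h_copies_separate[of R S i j] that assms by blast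
    then have "region (h_copy M (xi D i) R) = {}"
      unfolding eq by (simp add: disjnt_def)
    moreover have "on_grid (side (crossbar D)) (h_copy M (xi D i) R)"
      using on_grid_h_copy that assms by blast
    ultimately show False by (cases "h_copy M (xi D i) R") auto
  qed
  have fin: "finite I" using assms finite_rects finite_subset by blast
  have "card (\<Union>i<q. h_copy M (xi D i) ` I) = (\<Sum>i<q. card (h_copy M (xi D i) ` I))"
    using neq fin by (intro card_UN_disjoint) (auto 4 4)
  also have "\<dots> = (\<Sum>i<q. card I)"
    using M_pos by (intro sum.cong refl card_image inj_onI) (simp add: h_copy_inj)
  finally show ?thesis by simp
qed

lemma card_rects_crossbar: "card (rects (crossbar D)) = 2 * q * card (rects D)"
proof -
  let ?H = "\<Union>i<q. h_copy M (xi D i) ` rects D" and ?V = "\<Union>i<q. v_copy M (xi D i) ` rects D"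
  have V: "?V = flip ` ?H" by (simp add: image_UN image_image)
  have "card (rects (crossbar D)) = card ?H + card ?V"
    unfolding crossbar_simps using finite_rects h_copy_neq_v_copy
    by (intro card_Un_disjoint) (auto, blast?)
  also have "card ?V = card ?H" unfolding V by (rule card_image[OF inj_flip])
  finally show ?thesis using card_UN_h_copies[of "rects D"] by simp
qed

lemma crossbar_disjoint_family:
  assumes I: "I \<subseteq> rects D" "disjoint_rects I" "card I = q"
  shows "\<exists>J\<subseteq>rects (crossbar D). disjoint_rects J \<and> card J = num_markers (crossbar D)"
proof (intro exI conjI)
  let ?J = "\<Union>i<q. h_copy M (xi D i) ` I"
  show "?J \<subseteq> rects (crossbar D)" using I by (auto simp: crossbar_simps)
  show "card ?J = num_markers (crossbar D)"
    using card_UN_h_copies[of I] I by (simp add: crossbar_simps power2_eq_square)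
  have "disjnt (region (h_copy M (xi D i) R)) (region (h_copy M (xi D j) S))"
    if "R \<in> I" "S \<in> I" "i < q" "j < q" "h_copy M (xi D i) R \<noteq> h_copy M (xi D j) S" for R S i j
  proof (cases "i = j")
    case True
    then show ?thesis using that I M_pos
      by (auto simp: disjnt_h_copy_iff disjoint_rects_def pairwise_def)
  next
    case False
    then show ?thesis using h_copies_separate[of R S i j] that I by blast
  qed
  then show "disjoint_rects ?J" unfolding disjoint_rects_def pairwise_def by blast
qed

section \<open>The stabbing bound\<close>

text \<open>The inductive step of the upper bound. The horizontal bound of the old drawing enters for the columns
  outside \<open>U\<close>, the vertical one for all other parts of \<open>I\<close>.\<close>
lemma crossbar_vstabs_bound:
  assumes bound: "stab_bound D" and I: "I \<subseteq> rects (crossbar D)" "disjoint_rects I"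
  shows "card I \<le> card (vstabs (crossbar D) I)"
proof -
  define H where "H i = {R \<in> rects D. h_copy M (xi D i) R \<in> I}" for i
  define V where "V j = {S \<in> rects D. v_copy M (xi D j) S \<in> I}" for j
  define U where "U = (\<Union>i<q. vstabs D (H i))"
  have finH: "finite (H i)" "finite (V i)" for i
    using finite_rects by (auto simp: H_def V_def)
  have finv: "finite (vstabs D J)" "finite (hstabs D J)" for J
    by (auto simp: vstabs_def hstabs_def)
  have U: "U \<subseteq> {..<q}" and finU: "finite U"
    by (auto simp: U_def vstabs_def)
  have Hb: "card (H i) \<le> card (vstabs D (H i))" for i
  proof -
    have "disjoint_rects (H i)"
      unfolding disjoint_rects_def
    proof (rule pairwiseI)
      fix R S assume "R \<in> H i" "S \<in> H i" "R \<noteq> S"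
      then have "h_copy M (xi D i) R \<in> I" "h_copy M (xi D i) S \<in> I"
        "h_copy M (xi D i) R \<noteq> h_copy M (xi D i) S"
        by (auto simp: H_def h_copy_inj[OF M_pos])
      then have "disjnt (region (h_copy M (xi D i) R)) (region (h_copy M (xi D i) S))"
        by (rule disjoint_rectsD[OF I(2)])
      then show "disjnt (region R) (region S)" by (simp only: disjnt_h_copy_iff[OF M_pos])
    qed
    then show ?thesis using bound by (auto simp: stab_bound_def H_def)
  qed
  have Vb: "card (V j) \<le> card (vstabs D (V j))" "card (V j) \<le> card (hstabs D (V j))" for j
  proof -
    have "disjoint_rects (V j)"
      unfolding disjoint_rects_def
    proof (rule pairwiseI)
      fix R S assume "R \<in> V j" "S \<in> V j" "R \<noteq> S"
      then have "v_copy M (xi D j) R \<in> I" "v_copy M (xi D j) S \<in> I"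
        "v_copy M (xi D j) R \<noteq> v_copy M (xi D j) S"
        by (auto simp: V_def v_copy_inj[OF M_pos])
      then have "disjnt (region (v_copy M (xi D j) R)) (region (v_copy M (xi D j) S))"
        by (rule disjoint_rectsD[OF I(2)])
      then show "disjnt (region R) (region S)" by (simp only: disjnt_v_copy_iff[OF M_pos])
    qed
    then show "card (V j) \<le> card (vstabs D (V j))" "card (V j) \<le> card (hstabs D (V j))"
      using bound by (auto simp: stab_bound_def V_def)
  qed
  have "I \<subseteq> (\<Union>i<q. h_copy M (xi D i) ` H i) \<union> (\<Union>j<q. v_copy M (xi D j) ` V j)"
  proof
    fix X assume "X \<in> I"
    then have "X \<in> rects (crossbar D)" using I(1) by blast
    then consider "X \<in> (\<Union>i<q. h_copy M (xi D i) ` rects D)"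
      | "X \<in> (\<Union>j<q. v_copy M (xi D j) ` rects D)"
      unfolding crossbar_simps(1) by (elim UnE)
    then show "X \<in> (\<Union>i<q. h_copy M (xi D i) ` H i) \<union> (\<Union>j<q. v_copy M (xi D j) ` V j)"
    proof cases
      case 1
      then obtain i R where "i < q" "R \<in> rects D" "X = h_copy M (xi D i) R"
        by (elim UN_E imageE) simp
      moreover from this have "R \<in> H i" using \<open>X \<in> I\<close> by (simp add: H_def)
      ultimately show ?thesis by (intro UnI1 UN_I[of i]) simp_all
    next
      case 2
      then obtain j S where "j < q" "S \<in> rects D" "X = v_copy M (xi D j) S"
        by (elim UN_E imageE) simp
      moreover from this have "S \<in> V j" using \<open>X \<in> I\<close> by (simp add: V_def)
      ultimately show ?thesis by (intro UnI2 UN_I[of j]) simp_all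
    qed
  qed
  then have "card I \<le> card ((\<Union>i<q. h_copy M (xi D i) ` H i) \<union> (\<Union>j<q. v_copy M (xi D j) ` V j))"
    by (rule card_mono[rotated]) (intro finite_UnI finite_UN_I finite_imageI finH finite_lessThan)
  also have "\<dots> \<le> card (\<Union>i<q. h_copy M (xi D i) ` H i) + card (\<Union>j<q. v_copy M (xi D j) ` V j)"
    by (rule card_Un_le)
  also have "\<dots> \<le> (\<Sum>i<q. card (H i)) + (\<Sum>j<q. card (V j))"
    by (intro add_mono card_UN_image_le finite_lessThan finH)
  also have "(\<Sum>j<q. card (V j)) = (\<Sum>j\<in>U. card (V j)) + (\<Sum>j\<in>{..<q} - U. card (V j))"
    using sum.subset_diff[OF U finite_lessThan] by (simp only: add.commute)
  also have "(\<Sum>i<q. card (H i)) + \<dots> \<le>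
      (\<Sum>i<q. card (vstabs D (H i))) + ((\<Sum>j\<in>U. card (vstabs D (V j)))
        + (\<Sum>j\<in>{..<q} - U. card (hstabs D (V j))))"
    by (intro add_mono sum_mono Hb Vb)
  finally have 1: "card I \<le> \<dots>" .

  \<comment> \<open>Row \<open>i\<close> and column \<open>j\<close> may each claim the pair \<open>(i, j)\<close> with \<open>j \<in> U\<close>, but never both of them.\<close>
  let ?A = "SIGMA i:{..<q}. vstabs D (H i)" and ?B = "SIGMA j:U. vstabs D (V j)"
  have "?A \<inter> prod.swap ` ?B = {}"
  proof (rule ccontr)
    assume "?A \<inter> prod.swap ` ?B \<noteq> {}"
    then obtain i j where ij: "j \<in> vstabs D (H i)" "i \<in> vstabs D (V j)" by auto
    obtain R where R: "R \<in> H i" "xi D j \<in> xspan R" "j < q" using ij(1) by (auto simp: vstabs_def)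
    obtain S where S: "S \<in> V j" "xi D i \<in> xspan S" "i < q"
      using ij(2) by (auto simp: vstabs_def)
    let ?h = "h_copy M (xi D i) R" and ?v = "v_copy M (xi D j) S"
    have RS: "R \<in> rects D" "S \<in> rects D" and "?h \<in> I" "?v \<in> I"
      using R(1) S(1) by (simp_all add: H_def V_def)
    moreover have "?h \<noteq> ?v" using RS by (rule h_copy_neq_v_copy)
    ultimately have "disjnt (region ?h) (region ?v)"
      using disjoint_rectsD[OF I(2)] by blast
    then show False
      using h_copy_meets_v_copy[OF RS S(3) R(3) R(2) S(2)] by contradiction
  qed
  then have "card (?A \<union> prod.swap ` ?B) = card ?A + card (prod.swap ` ?B)"
    by (rule card_Un_disjoint[rotated 2]) (use finv finU in simp_all)
  also have "card (prod.swap ` ?B) = card ?B" by (intro card_image) auto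
  finally have "card ?A + card ?B = card (?A \<union> prod.swap ` ?B)" by simp
  also have "card (?A \<union> prod.swap ` ?B) \<le> card ({..<q} \<times> U)"
  proof (rule card_mono)
    have "?A \<subseteq> {..<q} \<times> U" by (auto simp: U_def)
    moreover have "?B \<subseteq> U \<times> {..<q}"
      by (intro Sigma_mono) (auto simp: vstabs_def)
    then have "prod.swap ` ?B \<subseteq> {..<q} \<times> U"
      by (metis image_mono product_swap)
    ultimately show "?A \<union> prod.swap ` ?B \<subseteq> {..<q} \<times> U" by (rule Un_least)
  qed (use finU in simp)
  finally have 2: "(\<Sum>i<q. card (vstabs D (H i))) + (\<Sum>j\<in>U. card (vstabs D (V j))) \<le> q * card U"
    using finv finU by simp

  \<comment> \<open>Index pairs of new vertical markers known to stab \<open>I\<close>: a full block for \<open>j \<in> U\<close>, and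
    otherwise only those whose offset stabs a rectangle of column \<open>j\<close>.\<close>
  let ?N = "SIGMA j:{..<q}. if j \<in> U then {..<q} else hstabs D (V j)"
  let ?\<phi> = "\<lambda>(j, t). j * q + t"
  have Nq: "?N \<subseteq> {..<q} \<times> {..<q}" by (auto simp: hstabs_def split: if_splits)
  have inj: "inj_on ?\<phi> ({..<q} \<times> {..<q})"
    by (rule inj_on_inverseI[where g = "\<lambda>k. (k div q, k mod q)"]) (clarsimp simp: pair_index(2,3))
  have "card ?N = card (?\<phi> ` ?N)"
    using inj_on_subset[OF inj Nq] by (rule card_image[symmetric])
  also have "\<dots> \<le> card (vstabs (crossbar D) I)"
  proof (intro card_mono subsetI)
    show "finite (vstabs (crossbar D) I)" by (auto simp: vstabs_def)
    fix k assume "k \<in> ?\<phi> ` ?N"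
    then obtain j t where jt: "(j, t) \<in> ?N" "k = j * q + t"
      by (auto simp del: mem_Sigma_iff)
    have q: "j < q" "t < q" using subsetD[OF Nq jt(1)] by simp_all
    have k: "xi (crossbar D) k = M * xi D j + eta D t" "k < num_markers (crossbar D)"
      using pair_index[OF q] by (auto simp: crossbar_simps jt)
    have "\<exists>R\<in>I. M * xi D j + eta D t \<in> xspan R"
    proof (cases "j \<in> U")
      case True
      then obtain i R where "R \<in> H i" "xi D j \<in> xspan R" by (auto simp: U_def vstabs_def)
      then show ?thesis
        using xi_stays_in_span[of R j "eta D t" "xi D i"] q markers_bounds[OF q(2)]
        by (auto simp: H_def)
    next
      case False
      then obtain S where S: "S \<in> V j" "eta D t \<in> yspan S" using jt by (auto simp: hstabs_def)
      then have "M * xi D j + eta D t \<in> xspan (v_copy M (xi D j) S)" by (cases S) simp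
      then show ?thesis using S by (auto simp: V_def)
    qed
    then show "k \<in> vstabs (crossbar D) I" using k by (auto simp: vstabs_def)
  qed
  also have "card ?N = (\<Sum>j<q. if j \<in> U then q else card (hstabs D (V j)))"
    using finv by (subst card_SigmaI) (auto intro!: sum.cong)
  also have "\<dots> = q * card U + (\<Sum>j\<in>{..<q} - U. card (hstabs D (V j)))"
    using U by (simp add: sum.If_cases Int_absorb1 Diff_eq Collect_neg_eq mult.commute)
  finally show ?thesis using 1 2 by linarith
qed

lemma stab_bound_crossbar:
  assumes "stab_bound D"
  shows "stab_bound (crossbar D)"
  unfolding stab_bound_def
proof (intro allI impI conjI)
  fix I assume I: "I \<subseteq> rects (crossbar D)" "disjoint_rects I"
  show "card I \<le> card (vstabs (crossbar D) I)"
    using crossbar_vstabs_bound[OF assms] I by blast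
  have "flip ` I \<subseteq> rects (crossbar D)" using I(1) crossbar_flip[of D] by blast
  then have "card (flip ` I) \<le> card (vstabs (crossbar D) (flip ` I))"
    using crossbar_vstabs_bound[OF assms] I(2) by (simp add: disjoint_rects_flip)
  then show "card I \<le> card (hstabs (crossbar D) I)"
    by (simp add: hstabs_crossbar card_image inj_flip)
qed

section \<open>From rectangles to point sets\<close>

lemma inj_on_region_rects: "inj_on region (rects D)"
  using inj_on_region[of "side D"] by (rule inj_on_subset) (simp add: rects_on_grid subsetI)

lemma disjoint_subfamily_iff_regions:
  assumes "I \<subseteq> rects D"
  shows "disjoint_rects I \<longleftrightarrow> pairwise disjnt (region ` I)"
  by (rule disjoint_rects_iff_regions[where L = "side D"], rule rects_on_grid, erule subsetD[OF assms])

lemma alpha_eq_num_markers: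
  assumes bound: "stab_bound D"
    and J: "J \<subseteq> rects D" "disjoint_rects J" "card J = q"
  shows "alpha (region ` rects D) = q"
proof -
  let ?F = "region ` rects D"
  have upper: "card S \<le> q" if S: "S \<subseteq> ?F" "pairwise disjnt S" for S
  proof -
    from S(1) obtain I where I: "I \<subseteq> rects D" "S = region ` I" by (rule subset_imageE)
    have "disjoint_rects I"
      using S(2) unfolding I(2) disjoint_subfamily_iff_regions[OF I(1)] .
    then have "card I \<le> card (vstabs D I)" using bound I(1) unfolding stab_bound_def by simp
    also have "\<dots> \<le> card {..<q}" by (intro card_mono) (auto simp: vstabs_def)
    finally show ?thesis unfolding I(2) card_image[OF inj_on_subset[OF inj_on_region_rects I(1)]] by simp
  qed
  show ?thesis
  proof (rule alpha_eqI[OF _ _ _ upper])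
    show "region ` J \<subseteq> ?F" using J(1) by (rule image_mono)
    show "pairwise disjnt (region ` J)"
      using J(2) unfolding disjoint_subfamily_iff_regions[OF J(1)] .
    show "card (region ` J) = q"
      unfolding card_image[OF inj_on_subset[OF inj_on_region_rects J(1)]] by (rule J(3))
  qed
qed

lemma card_regions: "card (region ` rects D) = card (rects D)"
  using inj_on_region_rects by (rule card_image)

end

section \<open>The base drawing\<close>

lemma less_4_cases: "k < (4::nat) \<longleftrightarrow> k = 0 \<or> k = 1 \<or> k = 2 \<or> k = 3"
  by auto

lemma grid_drawing_base: "grid_drawing base"
  by unfold_locales (auto simp: base_def less_4_cases inj_on_def)

lemma card_eq_sum_of_bool: "finite A \<Longrightarrow> I \<subseteq> A \<Longrightarrow> card I = (\<Sum>a\<in>A. of_bool (a \<in> I))"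
  by (simp add: sum.If_cases of_bool_def Int_absorb1)

text \<open>The stabbing bound of the base drawing in terms of membership of the eight rectangles: the
  assumptions are the edges of the intersection graph, and each summand on the right says which
  rectangles one marker stabs, in increasing order of the markers. The first bound is for vertical
  markers, the second for horizontal ones.\<close>
lemma base_counts:
  fixes t ul ur c0 c1 c2 c3 q :: bool
  assumes "\<not> (ul \<and> ur)" "\<not> (c0 \<and> c1)" "\<not> (c1 \<and> c2)" "\<not> (c2 \<and> c3)" "\<not> (c3 \<and> q)" "\<not> (q \<and> c0)"
  defines "n \<equiv> of_bool t + of_bool ul + of_bool ur + of_bool c0 + of_bool c1 + of_bool c2
    + of_bool c3 + of_bool q :: nat"
  shows "n \<le> of_bool (t \<or> ul \<or> c0) + of_bool (t \<or> ul \<or> c1 \<or> q)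
      + of_bool (t \<or> ur \<or> c2 \<or> q) + of_bool (t \<or> ur \<or> c3) \<and>
    n \<le> of_bool (c0 \<or> c3 \<or> q) + of_bool (c1 \<or> c2 \<or> c3) + of_bool (ul \<or> ur) + of_bool t"
  using assms(1-6) unfolding n_def
  by (cases t; cases ul; cases ur; cases c0; cases c1; cases c2; cases c3; cases q; simp)

lemma stab_bound_base: "stab_bound base"
  unfolding stab_bound_def
proof (intro allI impI)
  fix I assume I: "I \<subseteq> rects base" and "disjoint_rects I"
  then have dj: "\<not> (R \<in> I \<and> S \<in> I)" if "R \<noteq> S" "\<not> disjnt (region R) (region S)" for R S
    using that by (auto simp: disjoint_rects_def pairwise_def)
  let ?T = "Rect 0 30 26 28" and ?UL = "Rect 0 16 20 22" and ?UR = "Rect 14 30 20 22"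
  let ?C0 = "Rect 0 8 2 10" and ?C1 = "Rect 6 16 8 14" and ?C2 = "Rect 14 24 8 14"
  let ?C3 = "Rect 22 30 2 12" and ?Q = "Rect 6 24 0 4"
  have adj: "\<not> (?UL \<in> I \<and> ?UR \<in> I)" "\<not> (?C0 \<in> I \<and> ?C1 \<in> I)" "\<not> (?C1 \<in> I \<and> ?C2 \<in> I)"
    "\<not> (?C2 \<in> I \<and> ?C3 \<in> I)" "\<not> (?C3 \<in> I \<and> ?Q \<in> I)" "\<not> (?Q \<in> I \<and> ?C0 \<in> I)"
    by (rule dj; simp add: disjnt_def Times_Int_Times)+
  have cI: "card I = (\<Sum>R\<in>rects base. of_bool (R \<in> I))"
    using I by (intro card_eq_sum_of_bool) (auto simp: base_def)
  have ex: "(\<exists>R\<in>I. P R) \<longleftrightarrow> (\<exists>R\<in>rects base. R \<in> I \<and> P R)" for P using I by auto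
  have cv: "card (vstabs base I) = (\<Sum>k<4. of_bool (k \<in> vstabs base I))"
    by (intro card_eq_sum_of_bool) (auto simp: vstabs_def base_def)
  have ch: "card (hstabs base I) = (\<Sum>k<4. of_bool (k \<in> hstabs base I))"
    by (intro card_eq_sum_of_bool) (auto simp: hstabs_def base_def)
  have v: "0 \<in> vstabs base I \<longleftrightarrow> ?T \<in> I \<or> ?UL \<in> I \<or> ?C0 \<in> I"
    "1 \<in> vstabs base I \<longleftrightarrow> ?T \<in> I \<or> ?UL \<in> I \<or> ?C1 \<in> I \<or> ?Q \<in> I"
    "2 \<in> vstabs base I \<longleftrightarrow> ?T \<in> I \<or> ?UR \<in> I \<or> ?C2 \<in> I \<or> ?Q \<in> I"
    "3 \<in> vstabs base I \<longleftrightarrow> ?T \<in> I \<or> ?UR \<in> I \<or> ?C3 \<in> I"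
    unfolding vstabs_def ex by (simp_all add: base_def)
  have h: "0 \<in> hstabs base I \<longleftrightarrow> ?C0 \<in> I \<or> ?C3 \<in> I \<or> ?Q \<in> I"
    "1 \<in> hstabs base I \<longleftrightarrow> ?C1 \<in> I \<or> ?C2 \<in> I \<or> ?C3 \<in> I"
    "2 \<in> hstabs base I \<longleftrightarrow> ?UL \<in> I \<or> ?UR \<in> I"
    "3 \<in> hstabs base I \<longleftrightarrow> ?T \<in> I"
    unfolding hstabs_def ex by (simp_all add: base_def)
  have s4: "(\<Sum>k<4. f k) = f 0 + f 1 + f 2 + f 3" for f :: "nat \<Rightarrow> nat"
    by (simp add: eval_nat_numeral)
  have "card I = of_bool (?T \<in> I) + of_bool (?UL \<in> I) + of_bool (?UR \<in> I) + of_bool (?C0 \<in> I)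
      + of_bool (?C1 \<in> I) + of_bool (?C2 \<in> I) + of_bool (?C3 \<in> I) + of_bool (?Q \<in> I)"
    unfolding cI by (simp add: base_def)
  then show "card I \<le> card (vstabs base I) \<and> card I \<le> card (hstabs base I)"
    unfolding cv ch s4 v h using base_counts[OF adj] by metis
qed

text \<open>The witness consists of \<open>T\<close>, \<open>U\<^sub>L\<close>, and the nonadjacent vertices \<open>C\<^sub>0\<close>, \<open>C\<^sub>2\<close> of the 5-cycle.\<close>
lemma base_disjoint_family: "\<exists>J\<subseteq>rects base. disjoint_rects J \<and> card J = num_markers base"
proof (intro exI conjI)
  let ?J = "{Rect 0 30 26 28, Rect 0 16 20 22, Rect 0 8 2 10, Rect 14 24 8 14}"
  show "?J \<subseteq> rects base" "card ?J = num_markers base" by (auto simp: base_def)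
  show "disjoint_rects ?J"
    by (auto simp: disjoint_rects_def pairwise_insert disjnt_def)
qed

section \<open>The recursion\<close>

lemma drawing_of_invariants:
  "grid_drawing (drawing_of r) \<and> stab_bound (drawing_of r) \<and>
   (\<exists>J\<subseteq>rects (drawing_of r). disjoint_rects J \<and> card J = num_markers (drawing_of r))"
proof (induction r)
  case 0
  show ?case
    using grid_drawing_base stab_bound_base base_disjoint_family by simp
next
  case (Suc r)
  then interpret grid_drawing "drawing_of r" by simp
  show ?case
    using Suc grid_drawing_crossbar stab_bound_crossbar crossbar_disjoint_family by auto
qed

lemma num_markers_drawing_of: "num_markers (drawing_of r) = 4 ^ (2 ^ r)"
  by (induction r) (simp_all add: base_def crossbar_simps flip: power_mult)

lemma card_rects_drawing_of:
  "card (rects (drawing_of r)) = 2 ^ (r + 1) * num_markers (drawing_of r)"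
proof (induction r)
  case 0
  show ?case by (simp add: base_def)
next
  case (Suc r)
  interpret grid_drawing "drawing_of r" using drawing_of_invariants by blast
  show ?case
    using card_rects_crossbar Suc by (simp add: crossbar_simps power2_eq_square)
qed

theorem proposition11:
  fixes r :: nat
  shows "alpha (rect_family r) = marker_count r \<and> card (rect_family r) = 2 ^ (r + 1) * marker_count r \<and> marker_count r = 4 ^ (2 ^ r)"
proof -
  interpret grid_drawing "drawing_of r" using drawing_of_invariants by blast
  have "alpha (rect_family r) = marker_count r"
    using drawing_of_invariants[of r] alpha_eq_num_markers
    unfolding rect_family_def marker_count_def by blast
  then show ?thesis
    using card_rects_drawing_of num_markers_drawing_of card_regions
    by (simp add: rect_family_def marker_count_def)
qed

end
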